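(* Consider the distributed graph-embedded actors and critics of GE-VDAC defined in the context. If the aggregation functions $\phi_u^{(n)}(\cdot)$, for all types $u\in\{0,1\}$ (and all layers $n$), are permutation invariant (their value does not depend on the order in which the elements of their input collection are listed), then the distributed actors/critics of GE-VDAC satisfy permutation invariance, that is: for any two isomorphic communication graphs $\mathcal G\cong\mathcal G'$ with features related by a permutation $\nu$ through $(\mathbf O,\mathbf D)=\nu\star(\mathbf O',\mathbf D')$, the output joint action vectors $\mathbf a,\mathbf a'$ and the joint critic vectors $\mathbf v,\mathbf v'$ obtained on $\mathcal G$ and $\mathcal G'$, respectively, satisfy $$\mathbf a=\nu\star\mathbf a',\qquad\mathbf v=\nu\star\mathbf v'.$$
   Context: **Communication graph.** A finite set of agents (nodes) $\mathcal I=\mathcal I^0\cup\mathcal I^1$ ($\mathcal I^u$ is the set of agents of type $u\in\{0,1\}$) is the node set of a directed graph $\mathcal G$. Each node $i\in\mathcal I^u$ carries a feature vector $\mathbf o_i^u$, each directed edge $(i,i')$ a feature vector $\mathbf d_{ii'}$; $\mathbf O$ and $\mathbf D$ denote the node and edge features of $\mathcal G$. For $i\in\mathcal I^u$, $\mathcal N_{i-}^u$ is the set of nodes $i'$ such that $(i',i)$ is an edge (inbound neighbors). **Permutations.** A permutation $\nu$ of the agents acts by relabelling: $\nu\star\mathcal I$ denotes the permuted agents, $\nu\star(\mathbf O,\mathbf D)$ the correspondingly permuted graph features, and for a vector $\mathbf x=(\mathbf x_i)_{i\in\mathcal I}$ indexed by agents, $\nu\star\mathbf x$ is the vector with entries $(\nu\star\mathbf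 x)_i=\mathbf x_{\nu(i)}$. Graphs $\mathcal G,\mathcal G'$ with features $(\mathbf O,\mathbf D)$, $(\mathbf O',\mathbf D')$ are isomorphic, written $\mathcal G\cong\mathcal G'$, if there exists a permutation $\nu$ with $(\mathbf O,\mathbf D)=\nu\star(\mathbf O',\mathbf D')$. **Graph embedding.** Agents of the same type share the same functions (network parameters). Starting from $\mathbf z_{ui}^{(0)}=\mathbf o_i^u$ for $i\in\mathcal I^u$, a message passing graph neural network with $N$ layers computes, for $n=1,\dots,N$ and $i\in\mathcal I^u$, $$\mathbf z_{ui}^{(n)}=\Psi_u^{(n)}\Big(\mathbf z_{ui}^{(n-1)},\ \phi_u^{(n)}\big(\{\mathbf e_{i'i}^{(n)}\}_{i'\in\mathcal N_{i-}^u}\big)\Big),\qquad\mathbf e_{i'i}^{(n)}=\psi_{u'}^{(n)}\big(\mathbf z_{u'i'}^{(n-1)},\mathbf d_{i'i}\big)\ \text{ for } i'\in\mathcal I^{u'},$$ where $\psi_u^{(n)}$ (local embedding), $\Psi_u^{(n)}$ (combining) and $\phi_u^{(n)}$ (aggregation) are given functions. The local embedded state of agent $i\in\mathcal I^u$ is $\widetilde{\mathbf z}_i^u=[\mathbf o_i^u,\mathbf z_{ui}^{(N)}]$. **Actors and critics.** Agent $i\in\mathcal I^u$ samples its local action $\mathbf a_i^u$ from the type-$u$ action generation policy $\pi_{\theta_{\mathrm A}}^u(\cdot|\widetilde{\mathbf z}_i^u)$, and its local critic value is $V_\theta^u(\widetilde{\mathbf z}_i^u)$, where $V_\theta^u$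 is the type-$u$ critic function. The joint action vector is $\mathbf a=(\mathbf a_i^u)_{i\in\mathcal I}$ and the joint critic vector is $\mathbf v=(V_\theta^u(\widetilde{\mathbf z}_i^u))_{i\in\mathcal I}$. *)

theory Defs
  imports
    "HOL-Probability.Probability"
    "HOL-Combinatorics.Permutations"
    "Graph_Theory.Pair_Digraph"
begin

text \<open>
  Feature vectors, hidden states, messages and aggregates are real vectors whose dimension may
  differ between agent types and layers; lists cover all dimensions at once, and appending is
  concatenation. The type \<open>2\<close> of HOL-Library has exactly the two elements 0 and 1.
\<close>

type_synonym feat = "real list"

record 'i comm_graph =
  digraph_of :: "'i pair_pre_digraph"
  type_of :: "'i \<Rightarrow> 2"
  node_feat :: "'i \<Rightarrow> feat"
  edge_feat :: "'i \<Rightarrow> 'i \<Rightarrow> feat"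

abbreviation agents :: "'i comm_graph \<Rightarrow> 'i set" where
  "agents G \<equiv> pverts (digraph_of G)"

abbreviation edges :: "'i comm_graph \<Rightarrow> ('i \<times> 'i) set" where
  "edges G \<equiv> parcs (digraph_of G)"

definition in_nbrs :: "'i comm_graph \<Rightarrow> 'i \<Rightarrow> 'i set" where
  "in_nbrs G i = {j. (j, i) \<in> edges G}"

definition permute_vec :: "'i set \<Rightarrow> ('i \<Rightarrow> 'i) \<Rightarrow> ('i \<Rightarrow> 'b) \<Rightarrow> ('i \<Rightarrow> 'b)" where
  "permute_vec I \<nu> x = (\<lambda>i\<in>I. x (\<nu> i))"

text \<open>
  The relation \<open>(O, D) = \<nu> \<star> (O', D')\<close>. Node features are attached to typed agents and edge
  features exist exactly on the edges, so the relation includes the agreement of agent types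
  and of edges.
\<close>

definition feat_related_by :: "('i \<Rightarrow> 'i) \<Rightarrow> 'i comm_graph \<Rightarrow> 'i comm_graph \<Rightarrow> bool" where
  "feat_related_by \<nu> G G' \<longleftrightarrow>
     agents G = agents G' \<and> \<nu> permutes agents G \<and>
     (\<forall>i\<in>agents G. type_of G i = type_of G' (\<nu> i) \<and> node_feat G i = node_feat G' (\<nu> i)) \<and>
     (\<forall>i\<in>agents G. \<forall>j\<in>agents G. (i, j) \<in> edges G \<longleftrightarrow> (\<nu> i, \<nu> j) \<in> edges G') \<and>
     (\<forall>(i, j)\<in>edges G. edge_feat G i j = edge_feat G' (\<nu> i) (\<nu> j))"

text \<open>
  The functions depend on the agent only through its type; the natural number argument is the
  layer index in \<open>{1..layers P}\<close>.
\<close>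

record 'a ge_vdac =
  layers :: nat
  local_embed :: "2 \<Rightarrow> nat \<Rightarrow> feat \<Rightarrow> feat \<Rightarrow> feat"
  combine :: "2 \<Rightarrow> nat \<Rightarrow> feat \<Rightarrow> feat \<Rightarrow> feat"
  aggregate :: "2 \<Rightarrow> nat \<Rightarrow> feat list \<Rightarrow> feat"
  action_space :: "2 \<Rightarrow> 'a measure"
  actor :: "2 \<Rightarrow> feat \<Rightarrow> 'a measure"
  critic :: "2 \<Rightarrow> feat \<Rightarrow> real"

definition perm_invariant :: "('b list \<Rightarrow> 'c) \<Rightarrow> bool" where
  "perm_invariant f \<longleftrightarrow> (\<forall>xs ys. mset xs = mset ys \<longrightarrow> f xs = f ys)"

text \<open>
  An aggregation function receives its input collection as a list. The order in which agent \<open>i\<close>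
  lists its inbound neighbours at layer \<open>n\<close> is an arbitrary enumeration \<open>nb n i\<close>.
\<close>

definition nbr_listing :: "'i comm_graph \<Rightarrow> (nat \<Rightarrow> 'i \<Rightarrow> 'i list) \<Rightarrow> bool" where
  "nbr_listing G nb \<longleftrightarrow>
     (\<forall>n. \<forall>i\<in>agents G. distinct (nb n i) \<and> set (nb n i) = in_nbrs G i)"

primrec node_embedding ::
  "'a ge_vdac \<Rightarrow> 'i comm_graph \<Rightarrow> (nat \<Rightarrow> 'i \<Rightarrow> 'i list) \<Rightarrow> nat \<Rightarrow> 'i \<Rightarrow> feat" where
  "node_embedding P G nb 0 = node_feat G"
| "node_embedding P G nb (Suc n) = (\<lambda>i.
     combine P (type_of G i) (Suc n)
       (node_embedding P G nb n i)
       (aggregate P (type_of G i) (Suc n)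
          (map (\<lambda>j. local_embed P (type_of G j) (Suc n) (node_embedding P G nb n j) (edge_feat G j i))
             (nb (Suc n) i))))"

definition local_state ::
  "'a ge_vdac \<Rightarrow> 'i comm_graph \<Rightarrow> (nat \<Rightarrow> 'i \<Rightarrow> 'i list) \<Rightarrow> 'i \<Rightarrow> feat" where
  "local_state P G nb i = node_feat G i @ node_embedding P G nb (layers P) i"

definition joint_critic ::
  "'a ge_vdac \<Rightarrow> 'i comm_graph \<Rightarrow> (nat \<Rightarrow> 'i \<Rightarrow> 'i list) \<Rightarrow> ('i \<Rightarrow> real)" where
  "joint_critic P G nb = (\<lambda>i\<in>agents G. critic P (type_of G i) (local_state P G nb i))"

definition joint_action_space :: "'a ge_vdac \<Rightarrow> 'i comm_graph \<Rightarrow> ('i \<Rightarrow> 'a) measure" where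
  "joint_action_space P G = (\<Pi>\<^sub>M i\<in>agents G. action_space P (type_of G i))"

text \<open>
  A joint action vector is a random vector on a probability space \<open>M\<close>: given the local states,
  the agents sample independently, each from the policy of its type.
\<close>

definition joint_action ::
  "'a ge_vdac \<Rightarrow> 'i comm_graph \<Rightarrow> (nat \<Rightarrow> 'i \<Rightarrow> 'i list) \<Rightarrow> 'w measure \<Rightarrow> ('w \<Rightarrow> 'i \<Rightarrow> 'a) \<Rightarrow> bool" where
  "joint_action P G nb M a \<longleftrightarrow>
     prob_space M \<and>
     a \<in> M \<rightarrow>\<^sub>M joint_action_space P G \<and>
     prob_space.indep_vars M (\<lambda>i. action_space P (type_of G i)) (\<lambda>i \<omega>. a \<omega> i) (agents G) \<and>
     (\<forall>i\<in>agents G. distr M (action_space P (type_of G i)) (\<lambda>\<omega>. a \<omega> i) =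
        actor P (type_of G i) (local_state P G nb i))"

end

theory Submission
  imports Defs
begin

text \<open>
  By induction on the layer, the embedding of \<open>i\<close> in the first graph equals that of \<open>\<nu> i\<close> in the
  second: \<open>\<nu>\<close> maps inbound neighbours bijectively to inbound neighbours, so the two message
  lists agree as multisets. Hence corresponding agents have the same critic values and policies.
  Agents act independently, so the law of a joint action is the product of the policies, and
  reindexing the product along \<open>\<nu>\<close> relates the two laws.
\<close>

text \<open>For nonempty \<open>I\<close> this is the characterisation of independence by the
  product law, stated for a random vector \<open>X\<close> instead of a family of variables. For
  empty \<open>I\<close> both sides are probability measures on a one-point space.\<close>

lemma (in prob_space) distr_eq_PiM_distr_if_indep_vars:
  assumes "finite I" and X: "X \<in> M \<rightarrow>\<^sub>M PiM I N"
    and indep: "indep_vars N (\<lambda>i \<omega>. X \<omega> i) I"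
  shows "distr M (PiM I N) X = (\<Pi>\<^sub>M i\<in>I. distr M (N i) (\<lambda>\<omega>. X \<omega> i))"
proof (cases "I = {}")
  case True
  interpret D: prob_space "distr M (PiM I N) X"
    using X by (rule prob_space_distr)
  interpret E: prob_space "PiM I (\<lambda>i. distr M (N i) (\<lambda>\<omega>. X \<omega> i))"
    using True by (intro prob_space_PiM) auto
  show ?thesis
  proof (rule measure_eqI)
    fix A assume "A \<in> sets (distr M (PiM I N) X)"
    then have "A = {} \<or> A = {\<lambda>_. undefined}"
      using True by (auto simp: sets_PiM_empty)
    moreover have "{\<lambda>_. undefined} = space (distr M (PiM I N) X)"
      "{\<lambda>_. undefined} = space (PiM I (\<lambda>i. distr M (N i) (\<lambda>\<omega>. X \<omega> i)))"
      using True by (simp_all add: space_PiM)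
    ultimately show "emeasure (distr M (PiM I N) X) A =
        emeasure (PiM I (\<lambda>i. distr M (N i) (\<lambda>\<omega>. X \<omega> i))) A"
      using D.emeasure_space_1 E.emeasure_space_1 by (metis emeasure_empty)
  qed (use True in \<open>simp add: sets_PiM_empty\<close>)
next
  case False
  have "random_variable (N i) (\<lambda>\<omega>. X \<omega> i)" if "i \<in> I" for i
    using X that by (rule measurable_compose[OF _ measurable_component_singleton])
  then have "distr M (PiM I N) (\<lambda>\<omega>. \<lambda>i\<in>I. X \<omega> i) =
      (\<Pi>\<^sub>M i\<in>I. distr M (N i) (\<lambda>\<omega>. X \<omega> i))"
    using indep False indep_vars_iff_distr_eq_PiM'[of I "\<lambda>i \<omega>. X \<omega> i" N] by simp
  \<comment> \<open>Values of \<open>X\<close> lie in an extensional product, so restricting them to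
    \<open>I\<close> changes nothing.\<close>
  moreover have "(\<lambda>i\<in>I. X \<omega> i) = X \<omega>" if "\<omega> \<in> space M" for \<omega>
    using measurable_space[OF X that] by (auto simp: space_PiM PiE_restrict)
  ultimately show ?thesis
    by (metis (no_types, lifting) distr_cong)
qed

text \<open>Edges correspond under \<nu> only for pairs of agents; well-formedness puts the sources
  of edges among the agents, so the correspondence reaches every inbound neighbour.\<close>

lemma in_nbrs_related:
  assumes rel: "feat_related_by \<nu> G G'"
    and wf: "pair_wf_digraph (digraph_of G)" "pair_wf_digraph (digraph_of G')"
    and i: "i \<in> agents G"
  shows "in_nbrs G' (\<nu> i) = \<nu> ` in_nbrs G i"
proof (intro set_eqI iffI)
  have perm: "\<nu> permutes agents G" and ag: "agents G = agents G'"
    and edge: "\<And>i j. i \<in> agents G \<Longrightarrow> j \<in> agents G \<Longrightarrow> (i, j) \<in> edges G \<longleftrightarrow> (\<nu> i, \<nu> j) \<in> edges G'"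
    using rel by (auto simp: feat_related_by_def)
  fix k
  {
    assume "k \<in> in_nbrs G' (\<nu> i)"
    then have k: "(k, \<nu> i) \<in> edges G'" by (simp add: in_nbrs_def)
    \<comment> \<open>Surjectivity of \<nu> on the agents provides the preimage of
      \<open>k\<close>.\<close>
    then have "k \<in> \<nu> ` agents G"
      using pair_wf_digraph.in_arcsD1[OF wf(2)] ag permutes_image[OF perm] by simp
    then show "k \<in> \<nu> ` in_nbrs G i"
      using k edge i by (auto simp: in_nbrs_def)
  }
  {
    assume "k \<in> \<nu> ` in_nbrs G i"
    then show "k \<in> in_nbrs G' (\<nu> i)"
      using edge i pair_wf_digraph.in_arcsD1[OF wf(1)] by (auto simp: in_nbrs_def)
  }
qed

text \<open>The listings \<open>nb\<close> and \<open>nb'\<close> are chosen independently, so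
  corresponding messages may come in different orders; permutation invariance absorbs this. The
  bound on \<open>n\<close> keeps the induction within the layers where invariance is
  assumed.\<close>

lemma node_embedding_related:
  assumes wf: "pair_wf_digraph (digraph_of G)" "pair_wf_digraph (digraph_of G')"
    and agg: "\<And>u n. n \<in> {1..layers P} \<Longrightarrow> perm_invariant (aggregate P u n)"
    and nb: "nbr_listing G nb" "nbr_listing G' nb'"
    and rel: "feat_related_by \<nu> G G'"
    and "n \<le> layers P" "i \<in> agents G"
  shows "node_embedding P G nb n i = node_embedding P G' nb' n (\<nu> i)"
  using \<open>n \<le> layers P\<close> \<open>i \<in> agents G\<close>
proof (induction n arbitrary: i)
  case 0
  then show ?case using rel by (simp add: feat_related_by_def)
next
  case (Suc n)
  have perm: "\<nu> permutes agents G"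
    and ty: "\<And>i. i \<in> agents G \<Longrightarrow> type_of G i = type_of G' (\<nu> i)"
    and ef: "\<And>i j. (i, j) \<in> edges G \<Longrightarrow> edge_feat G i j = edge_feat G' (\<nu> i) (\<nu> j)"
    and \<nu>i: "\<nu> i \<in> agents G'"
    using rel Suc.prems(2) by (auto simp: feat_related_by_def permutes_in_image)
  let ?m = "\<lambda>j. local_embed P (type_of G j) (Suc n) (node_embedding P G nb n j) (edge_feat G j i)"
  let ?m' = "\<lambda>j. local_embed P (type_of G' j) (Suc n) (node_embedding P G' nb' n j) (edge_feat G' j (\<nu> i))"
  have "distinct (nb (Suc n) i)" "set (nb (Suc n) i) = in_nbrs G i"
    using nb(1) Suc.prems(2) by (auto simp: nbr_listing_def)
  then have ms: "mset (nb (Suc n) i) = mset_set (in_nbrs G i)"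
    by (metis mset_set_set)
  have "distinct (nb' (Suc n) (\<nu> i))" "set (nb' (Suc n) (\<nu> i)) = \<nu> ` in_nbrs G i"
    using nb(2) \<nu>i in_nbrs_related[OF rel wf Suc.prems(2)] by (auto simp: nbr_listing_def)
  then have "mset (nb' (Suc n) (\<nu> i)) = mset_set (\<nu> ` in_nbrs G i)"
    by (metis mset_set_set)
  \<comment> \<open>Injectivity of \<nu> prevents two neighbours from merging, so multiplicities are
    kept.\<close>
  also have "\<dots> = image_mset \<nu> (mset_set (in_nbrs G i))"
    using permutes_inj_on[OF perm] by (simp add: image_mset_mset_set)
  finally have ms': "mset (nb' (Suc n) (\<nu> i)) = image_mset \<nu> (mset (nb (Suc n) i))"
    by (simp add: ms)
  \<comment> \<open>The induction hypothesis is applied at the neighbour \<open>j\<close>, hence the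
    generalisation over \<open>i\<close>.\<close>
  have msg: "?m j = ?m' (\<nu> j)" if "j \<in> set (nb (Suc n) i)" for j
  proof -
    have e: "(j, i) \<in> edges G"
      using that \<open>set (nb (Suc n) i) = in_nbrs G i\<close> by (simp add: in_nbrs_def)
    then have "j \<in> agents G" by (rule pair_wf_digraph.in_arcsD1[OF wf(1)])
    then show ?thesis using e ty ef Suc by simp
  qed
  have "mset (map ?m (nb (Suc n) i)) = mset (map ?m' (nb' (Suc n) (\<nu> i)))"
    unfolding mset_map ms' multiset.map_comp comp_def
    using msg by (intro image_mset_cong) simp
  moreover have "perm_invariant (aggregate P (type_of G i) (Suc n))"
    using agg Suc.prems(1) by simp
  ultimately have "aggregate P (type_of G i) (Suc n) (map ?m (nb (Suc n) i)) =
      aggregate P (type_of G i) (Suc n) (map ?m' (nb' (Suc n) (\<nu> i)))"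
    unfolding perm_invariant_def by blast
  then show ?case using Suc ty[OF Suc.prems(2)] by simp
qed

lemma distr_joint_action:
  assumes "joint_action P G nb M a" and "finite (agents G)"
  shows "distr M (joint_action_space P G) a =
    (\<Pi>\<^sub>M i\<in>agents G. actor P (type_of G i) (local_state P G nb i))"
proof -
  interpret prob_space M using assms(1) by (simp add: joint_action_def)
  show ?thesis
    unfolding joint_action_space_def using assms(1)
    by (subst distr_eq_PiM_distr_if_indep_vars[OF assms(2)])
      (auto simp: joint_action_def joint_action_space_def intro!: PiM_cong)
qed

text \<open>A policy is a priori an arbitrary measure. As the law of a sampled action it is a
  probability measure on the right sigma-algebra, which reindexing the product requires.\<close>

lemma joint_action_actor:
  assumes "joint_action P G nb M a" and "i \<in> agents G"
  shows "prob_space (actor P (type_of G i) (local_state P G nb i))"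
    and "sets (actor P (type_of G i) (local_state P G nb i)) = sets (action_space P (type_of G i))"
proof -
  interpret prob_space M using assms(1) by (simp add: joint_action_def)
  have "a \<in> M \<rightarrow>\<^sub>M (\<Pi>\<^sub>M i\<in>agents G. action_space P (type_of G i))"
    using assms(1) by (simp add: joint_action_def joint_action_space_def)
  then have "(\<lambda>\<omega>. a \<omega> i) \<in> M \<rightarrow>\<^sub>M action_space P (type_of G i)"
    using assms(2) by (rule measurable_compose[OF _ measurable_component_singleton])
  moreover have d: "actor P (type_of G i) (local_state P G nb i) =
      distr M (action_space P (type_of G i)) (\<lambda>\<omega>. a \<omega> i)"
    using assms by (simp add: joint_action_def)
  ultimately show "prob_space (actor P (type_of G i) (local_state P G nb i))"
    by (simp add: prob_space_distr)
  show "sets (actor P (type_of G i) (local_state P G nb i)) = sets (action_space P (type_of G i))"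
    by (simp add: d)
qed

text \<open>Actions are sampled, possibly on different probability spaces, so their relation is
  equality in law; critic values are deterministic and agree as vectors.\<close>

theorem proposition1:
  fixes P :: "'a ge_vdac"
    and G G' :: "'i comm_graph"
    and \<nu> :: "'i \<Rightarrow> 'i"
    and nb nb' :: "nat \<Rightarrow> 'i \<Rightarrow> 'i list"
  assumes "pair_fin_digraph (digraph_of G)" and "pair_fin_digraph (digraph_of G')"
    and "\<And>u n. n \<in> {1..layers P} \<Longrightarrow> perm_invariant (aggregate P u n)"
    and "nbr_listing G nb" and "nbr_listing G' nb'"
    and "feat_related_by \<nu> G G'"
  shows "(\<forall>(M :: 'w measure) (M' :: 'v measure) a a'.
            joint_action P G nb M a \<and> joint_action P G' nb' M' a' \<longrightarrow>
            distr M (joint_action_space P G) a =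
            distr M' (joint_action_space P G) (\<lambda>\<omega>. permute_vec (agents G) \<nu> (a' \<omega>))) \<and>
         joint_critic P G nb = permute_vec (agents G) \<nu> (joint_critic P G' nb')"
proof (intro conjI allI impI)
  have wf: "pair_wf_digraph (digraph_of G)" "pair_wf_digraph (digraph_of G')"
    and fin: "finite (agents G)"
    using assms(1,2) by (simp_all add: pair_fin_digraph.axioms(1) pair_fin_digraph.pair_finite_verts)
  have ag: "agents G' = agents G" and perm: "\<nu> permutes agents G"
    and ty: "\<And>i. i \<in> agents G \<Longrightarrow> type_of G i = type_of G' (\<nu> i)"
    and nf: "\<And>i. i \<in> agents G \<Longrightarrow> node_feat G i = node_feat G' (\<nu> i)"
    using assms(6) by (auto simp: feat_related_by_def)
  have \<nu>: "\<And>i. i \<in> agents G \<Longrightarrow> \<nu> i \<in> agents G"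
    using perm by (simp add: permutes_in_image)
  have state: "local_state P G nb i = local_state P G' nb' (\<nu> i)" if "i \<in> agents G" for i
    using node_embedding_related[OF wf assms(3-6) order_refl that] nf[OF that]
    by (simp add: local_state_def)
  show "joint_critic P G nb = permute_vec (agents G) \<nu> (joint_critic P G' nb')"
    by (auto simp: joint_critic_def permute_vec_def ag ty state \<nu> fun_eq_iff)

  fix M :: "'w measure" and M' :: "'v measure" and a a'
  assume "joint_action P G nb M a \<and> joint_action P G' nb' M' a'"
  then have a: "joint_action P G nb M a" and a': "joint_action P G' nb' M' a'" by simp_all
  let ?\<pi> = "\<lambda>i. actor P (type_of G' i) (local_state P G' nb' i)"
  let ?r = "permute_vec (agents G) \<nu> :: ('i \<Rightarrow> 'a) \<Rightarrow> _"
  \<comment> \<open>Writing the factor at \<open>i\<close> as that of \<open>G'\<close> at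
    \<open>\<nu> i\<close> makes \<open>?r\<close> measurable coordinate by coordinate.\<close>
  have space: "joint_action_space P G = (\<Pi>\<^sub>M i\<in>agents G. action_space P (type_of G' (\<nu> i)))"
    by (simp add: joint_action_space_def ty cong: PiM_cong)
  have r: "?r \<in> joint_action_space P G' \<rightarrow>\<^sub>M joint_action_space P G"
    unfolding space unfolding permute_vec_def joint_action_space_def ag
    by (intro measurable_restrict measurable_component_singleton \<nu>)
  \<comment> \<open>A pushforward depends on its target only through the measurable sets, so the
    target may become the product of the policies.\<close>
  have sets: "sets (joint_action_space P G) = sets (\<Pi>\<^sub>M i\<in>agents G. ?\<pi> (\<nu> i))"
    unfolding space using joint_action_actor(2)[OF a'] \<nu> by (intro sets_PiM_cong) (auto simp: ag)
  have "distr M' (joint_action_space P G) (\<lambda>\<omega>. ?r (a' \<omega>)) =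
      distr (distr M' (joint_action_space P G') a') (joint_action_space P G) ?r"
    using r a' by (subst distr_distr) (auto simp: joint_action_def comp_def)
  also have "\<dots> = distr (\<Pi>\<^sub>M i\<in>agents G. ?\<pi> i) (joint_action_space P G) ?r"
    using distr_joint_action[OF a'] fin by (simp add: ag)
  also have "\<dots> = distr (\<Pi>\<^sub>M i\<in>agents G. ?\<pi> i) (\<Pi>\<^sub>M i\<in>agents G. ?\<pi> (\<nu> i))
      (\<lambda>x. \<lambda>i\<in>agents G. x (\<nu> i))"
    using sets by (intro distr_cong) (simp_all add: permute_vec_def)
  \<comment> \<open>Selecting coordinates along an injection sends a product of probability measures
    to the product of the selected factors.\<close>
  also have "\<dots> = (\<Pi>\<^sub>M i\<in>agents G. ?\<pi> (\<nu> i))"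
    using joint_action_actor(1)[OF a'] permutes_inj_on[OF perm] \<nu>
    by (intro distr_PiM_reindex) (auto simp: ag)
  also have "\<dots> = (\<Pi>\<^sub>M i\<in>agents G. actor P (type_of G i) (local_state P G nb i))"
    by (simp add: ty state cong: PiM_cong)
  also have "\<dots> = distr M (joint_action_space P G) a"
    using distr_joint_action[OF a fin] by simp
  finally show "distr M (joint_action_space P G) a =
      distr M' (joint_action_space P G) (\<lambda>\<omega>. permute_vec (agents G) \<nu> (a' \<omega>))" by simp
qed

end
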